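(* Let $n\ge 5$ and let $G$ be a connected (finite simple) graph with $n$ vertices. Then $\alpha'_f(G)-\alpha'(G)\le \frac{n-2}{6}$, and equality holds only when either (i) $n=5$ and either $C_5$ is a subgraph of $G$ or $K_2+K_3$ is a subgraph of $G$, or (ii) $G$ has a vertex $v$ such that the components of $G-v$ are all copies of $K_3$ except for one component which is a single vertex.
   Context: $\alpha'(G)$ is the maximum size of a matching (set of pairwise disjoint edges) in $G$. A fractional matching of $G$ is a function $\phi:E(G)\to[0,1]$ with $\sum_{e\ni v}\phi(e)\le 1$ for every vertex $v$; its size is $\sum_{e\in E(G)}\phi(e)$, and $\alpha'_f(G)$ is the maximum size of a fractional matching of $G$. $K_2+K_3$ denotes the disjoint union of $K_2$ and $K_3$. *)

theory Defs
  imports "HOL-Analysis.Analysis"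
begin

record 'a graph =
  verts :: "'a set"
  edges :: "'a set set"

definition finite_simple_graph :: "'a graph \<Rightarrow> bool" where
  "finite_simple_graph G \<longleftrightarrow>
     finite (verts G) \<and> (\<forall>e\<in>edges G. e \<subseteq> verts G \<and> card e = 2)"

definition adj_rel :: "'a graph \<Rightarrow> ('a \<times> 'a) set" where
  "adj_rel G = {(u, v). {u, v} \<in> edges G}"

definition connected_graph :: "'a graph \<Rightarrow> bool" where
  "connected_graph G \<longleftrightarrow>
     verts G \<noteq> {} \<and> (\<forall>u\<in>verts G. \<forall>v\<in>verts G. (u, v) \<in> (adj_rel G)\<^sup>*)"

definition induced_subgraph :: "'a graph \<Rightarrow> 'a set \<Rightarrow> 'a graph" where
  "induced_subgraph G W =
     \<lparr>verts = verts G \<inter> W, edges = {e \<in> edges G. e \<subseteq> W}\<rparr>"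

definition delete_vertex :: "'a graph \<Rightarrow> 'a \<Rightarrow> 'a graph" where
  "delete_vertex G v = induced_subgraph G (verts G - {v})"

definition components_of_graph :: "'a graph \<Rightarrow> 'a graph set" where
  "components_of_graph G =
     {induced_subgraph G {w \<in> verts G. (u, w) \<in> (adj_rel G)\<^sup>*} | u. u \<in> verts G}"

definition graph_isomorphic :: "'a graph \<Rightarrow> 'b graph \<Rightarrow> bool" where
  "graph_isomorphic G H \<longleftrightarrow>
     (\<exists>f. bij_betw f (verts G) (verts H) \<and> edges H = (\<lambda>e. f ` e) ` edges G)"

definition is_subgraph :: "'a graph \<Rightarrow> 'a graph \<Rightarrow> bool" where
  "is_subgraph H G \<longleftrightarrow> finite_simple_graph H \<and> verts H \<subseteq> verts G \<and> edges H \<subseteq> edges G"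

text \<open>\<open>contains_copy G H\<close>: some (not necessarily induced) subgraph of \<open>G\<close> is isomorphic to \<open>H\<close>.\<close>

definition contains_copy :: "'a graph \<Rightarrow> 'b graph \<Rightarrow> bool" where
  "contains_copy G H \<longleftrightarrow> (\<exists>S. is_subgraph S G \<and> graph_isomorphic S H)"

definition complete_graph :: "nat \<Rightarrow> nat graph" where
  "complete_graph k = \<lparr>verts = {..<k}, edges = {e. e \<subseteq> {..<k} \<and> card e = 2}\<rparr>"

text \<open>Only meaningful for \<open>k \<ge> 3\<close>.\<close>

definition cycle_graph :: "nat \<Rightarrow> nat graph" where
  "cycle_graph k = \<lparr>verts = {..<k}, edges = {{i, (i + 1) mod k} | i. i < k}\<rparr>"

definition disjoint_union_graph :: "'a graph \<Rightarrow> 'b graph \<Rightarrow> ('a + 'b) graph" where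
  "disjoint_union_graph G H =
     \<lparr>verts = verts G <+> verts H,
      edges = (\<lambda>e. Inl ` e) ` edges G \<union> (\<lambda>e. Inr ` e) ` edges H\<rparr>"

definition matching :: "'a graph \<Rightarrow> 'a set set \<Rightarrow> bool" where
  "matching G M \<longleftrightarrow> M \<subseteq> edges G \<and> pairwise disjnt M"

definition matching_number :: "'a graph \<Rightarrow> nat" where
  "matching_number G = Max {card M | M. matching G M}"

text \<open>Values of \<open>\<phi>\<close> outside \<open>edges G\<close> are irrelevant.\<close>

definition fractional_matching :: "'a graph \<Rightarrow> ('a set \<Rightarrow> real) \<Rightarrow> bool" where
  "fractional_matching G \<phi> \<longleftrightarrow>
     \<phi> \<in> edges G \<rightarrow> {0..1} \<and> (\<forall>v\<in>verts G. (\<Sum>e\<in>{e \<in> edges G. v \<in> e}. \<phi> e) \<le> 1)"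

definition fractional_matching_size :: "'a graph \<Rightarrow> ('a set \<Rightarrow> real) \<Rightarrow> real" where
  "fractional_matching_size G \<phi> = (\<Sum>e\<in>edges G. \<phi> e)"

text \<open>For a finite graph this supremum is attained; see \<open>fractional_matching_number_attained\<close>.\<close>

definition fractional_matching_number :: "'a graph \<Rightarrow> real" where
  "fractional_matching_number G =
     Sup {fractional_matching_size G \<phi> | \<phi>. fractional_matching G \<phi>}"

lemma fractional_matching_number_attained:
  assumes "finite_simple_graph G"
  shows "\<exists>\<phi>. fractional_matching G \<phi> \<and>
           fractional_matching_size G \<phi> = fractional_matching_number G \<and>
           (\<forall>\<psi>. fractional_matching G \<psi> \<longrightarrow>
              fractional_matching_size G \<psi> \<le> fractional_matching_size G \<phi>)"
proof -
  define K where "K = {\<phi>. fractional_matching G \<phi> \<and> (\<forall>e. e \<notin> edges G \<longrightarrow> \<phi> e = 0)}"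
  have compactP: "compact (Pi\<^sub>E UNIV (\<lambda>e. if e \<in> edges G then {0..1::real} else {0}))"
  proof -
    have "compactin (product_topology (\<lambda>_. euclidean) UNIV)
        (Pi\<^sub>E UNIV (\<lambda>e. if e \<in> edges G then {0..1::real} else {0}))"
      by (subst compactin_PiE) auto
    then show ?thesis
      by (simp add: euclidean_product_topology)
  qed
  have closed1: "closed {\<phi> :: 'a set \<Rightarrow> real. (\<Sum>e\<in>{e \<in> edges G. v \<in> e}. \<phi> e) \<le> 1}" for v
    by (intro closed_Collect_le continuous_intros continuous_on_product_coordinates)
  have "K = Pi\<^sub>E UNIV (\<lambda>e. if e \<in> edges G then {0..1::real} else {0}) \<inter>
      (\<Inter>v\<in>verts G. {\<phi>. (\<Sum>e\<in>{e \<in> edges G. v \<in> e}. \<phi> e) \<le> 1})"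
    by (auto simp: K_def fractional_matching_def PiE_def Pi_def split: if_splits)
  then have "compact K"
    using compactP closed1 by (auto intro!: compact_Int_closed closed_INT)
  moreover have "(\<lambda>_. 0) \<in> K"
    by (auto simp: K_def fractional_matching_def)
  moreover have "continuous_on K (fractional_matching_size G)"
    unfolding fractional_matching_size_def
    by (intro continuous_on_sum continuous_on_subset[OF continuous_on_product_coordinates]) auto
  ultimately obtain \<phi> where \<phi>: "\<phi> \<in> K"
      "\<And>\<psi>. \<psi> \<in> K \<Longrightarrow> fractional_matching_size G \<psi> \<le> fractional_matching_size G \<phi>"
    using continuous_attains_sup[of K "fractional_matching_size G"] by blast
  have max: "fractional_matching_size G \<psi> \<le> fractional_matching_size G \<phi>"
    if "fractional_matching G \<psi>" for \<psi>
  proof -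
    define \<rho> where "\<rho> e = (if e \<in> edges G then \<psi> e else 0)" for e
    have "(\<Sum>e\<in>{e \<in> edges G. v \<in> e}. \<rho> e) = (\<Sum>e\<in>{e \<in> edges G. v \<in> e}. \<psi> e)" for v
      by (rule sum.cong) (auto simp: \<rho>_def)
    then have "\<rho> \<in> K"
      using that by (auto simp: K_def fractional_matching_def Pi_def) (auto simp: \<rho>_def)
    moreover have "fractional_matching_size G \<rho> = fractional_matching_size G \<psi>"
      by (simp add: fractional_matching_size_def \<rho>_def)
    ultimately show ?thesis using \<phi>(2) by metis
  qed
  have "fractional_matching G \<phi>" using \<phi>(1) by (simp add: K_def)
  moreover from this have "fractional_matching_number G = fractional_matching_size G \<phi>"
    unfolding fractional_matching_number_def using max by (intro cSup_eq_maximum) auto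
  ultimately show ?thesis using max by metis
qed

end

theory Submission
  imports Defs
begin

text \<open>
  Choose a vertex set \<open>S\<close> of maximum size with \<open>\<alpha>'(G) = \<alpha>'(G - S) + |S|\<close>. Then every vertex of
  \<open>G - S\<close> is missed by some maximum matching of \<open>G - S\<close>, so by Gallai's lemma the components of
  \<open>G - S\<close> are factor-critical. If \<open>i\<close> of them are single vertices and \<open>x\<close> are larger, then
  \<open>2 \<alpha>'(G) \<ge> n + |S| - (i + x)\<close>, while weak linear programming duality gives
  \<open>2 \<alpha>'\<^sub>f(G) \<le> n - max 0 (i - |S|)\<close>. Since the larger components have at least three vertices,
  \<open>|S| + i + 3 x \<le> n\<close>, and the bound follows. For \<open>S \<noteq> {}\<close> equality forces \<open>|S| = i = 1\<close>
  and all other components to be factor-critical on three vertices, i.e. triangles; for \<open>S = {}\<close> it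
  forces \<open>G\<close> to be factor-critical on five vertices.
\<close>

section \<open>Maximum matchings\<close>

definition maximum_matching :: "'a graph \<Rightarrow> 'a set set \<Rightarrow> bool" where
  "maximum_matching G M \<longleftrightarrow> matching G M \<and> card M = matching_number G"

lemma finite_edges:
  assumes "finite_simple_graph G"
  shows "finite (edges G)"
proof (rule finite_subset)
  show "edges G \<subseteq> Pow (verts G)" "finite (Pow (verts G))"
    using assms by (auto simp: finite_simple_graph_def)
qed

lemma edge_cases:
  assumes "finite_simple_graph G" "e \<in> edges G" "x \<in> e"
  obtains y where "e = {x, y}" "x \<noteq> y" "x \<in> verts G" "y \<in> verts G"
proof -
  have "card e = 2" "e \<subseteq> verts G" using assms by (auto simp: finite_simple_graph_def)
  then show thesis using that assms(3) by (auto simp: card_2_iff)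
qed

lemma finite_matching:
  assumes "finite_simple_graph G" "matching G M"
  shows "finite M"
  using assms finite_edges finite_subset unfolding matching_def by metis

lemma card_Union_matching:
  assumes "finite_simple_graph G" "matching G M"
  shows "finite (\<Union>M)" "card (\<Union>M) = 2 * card M"
proof -
  have e: "card e = 2 \<and> finite e" if "e \<in> M" for e
  proof -
    have "card e = 2" using assms that by (auto simp: finite_simple_graph_def matching_def)
    then show ?thesis by (metis card.infinite zero_neq_numeral)
  qed
  show "finite (\<Union>M)" using e finite_matching[OF assms] by blast
  have "card (\<Union>M) = sum card M"
    by (rule card_Union_disjoint) (use e assms in \<open>auto simp: matching_def\<close>)
  then show "card (\<Union>M) = 2 * card M" using e by simp
qed

lemma finite_matching_sizes:
  assumes "finite_simple_graph G"
  shows "finite {card M | M. matching G M}"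
proof -
  have "{card M | M. matching G M} \<subseteq> card ` Pow (edges G)" by (auto simp: matching_def)
  then show ?thesis using finite_edges[OF assms] by (meson finite_Pow_iff finite_imageI finite_subset)
qed

lemma card_matching_le:
  assumes "finite_simple_graph G" "matching G M"
  shows "card M \<le> matching_number G"
  unfolding matching_number_def
  by (rule Max_ge) (use assms finite_matching_sizes in auto)

lemma maximum_matching_exists:
  assumes "finite_simple_graph G"
  obtains M where "maximum_matching G M"
proof -
  have "matching G {}" by (simp add: matching_def)
  then have "matching_number G \<in> {card M | M. matching G M}"
    unfolding matching_number_def using finite_matching_sizes[OF assms] by (intro Max_in) auto
  then show thesis using that by (auto simp: maximum_matching_def)
qed

lemma matching_insert:
  assumes "matching G M" "e \<in> edges G" "e \<inter> \<Union>M = {}"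
  shows "matching G (insert e M)"
  using assms by (auto simp: matching_def pairwise_insert disjnt_def)

lemma matching_edges_eq:
  assumes "matching G M" "e \<in> M" "f \<in> M" "x \<in> e" "x \<in> f"
  shows "e = f"
  using assms unfolding matching_def pairwise_def disjnt_def by blast

text \<open>Otherwise the edge could be added to \<open>M\<close>.\<close>

lemma maximum_matching_covers_edge:
  assumes "finite_simple_graph G" "maximum_matching G M" "{x, y} \<in> edges G" "x \<notin> \<Union>M"
  shows "y \<in> \<Union>M"
proof (rule ccontr)
  assume "y \<notin> \<Union>M"
  then have "matching G (insert {x, y} M)"
    using assms by (intro matching_insert) (auto simp: maximum_matching_def)
  then have "card (insert {x, y} M) \<le> card M"
    using card_matching_le assms unfolding maximum_matching_def by metis
  moreover have "finite M" "{x, y} \<notin> M"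
    using assms finite_matching by (auto simp: maximum_matching_def)
  ultimately show False by simp
qed

section \<open>Gallai's lemma\<close>

text \<open>The core of Gallai's lemma, by an extremal choice. Among the maximum matchings missing
  \<open>t\<close>, take \<open>M\<close> with the most edges in common with \<open>N\<close>.
  Exchanging a suitable edge of \<open>M\<close> for one of \<open>N\<close> yields another such
  matching that agrees more with \<open>N\<close>.\<close>

lemma maximum_matching_exchange:
  assumes G: "finite_simple_graph G"
    and N: "maximum_matching G N" "u \<notin> \<Union>N" "v \<notin> \<Union>N" "u \<noteq> v"
    and M0: "maximum_matching G M0" "t \<notin> \<Union>M0"
    and cov: "\<And>M. maximum_matching G M \<Longrightarrow> t \<notin> \<Union>M \<Longrightarrow> u \<in> \<Union>M \<and> v \<in> \<Union>M"
  shows False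
proof -
  have fN: "finite N" using G N(1) finite_matching by (auto simp: maximum_matching_def)
  have "\<exists>M. (maximum_matching G M \<and> t \<notin> \<Union>M) \<and>
      (\<forall>M'. maximum_matching G M' \<and> t \<notin> \<Union>M' \<longrightarrow> card (M' \<inter> N) \<le> card (M \<inter> N))"
  proof (rule ex_has_greatest_nat)
    show "maximum_matching G M0 \<and> t \<notin> \<Union>M0" using M0 by simp
    show "\<forall>M. maximum_matching G M \<and> t \<notin> \<Union>M \<longrightarrow> card (M \<inter> N) < Suc (card N)"
      using fN by (simp add: card_mono less_Suc_eq_le)
  qed
  then obtain M where *: "maximum_matching G M \<and> t \<notin> \<Union>M"
      "\<forall>M'. maximum_matching G M' \<and> t \<notin> \<Union>M' \<longrightarrow> card (M' \<inter> N) \<le> card (M \<inter> N)"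
    by (elim exE) (erule conjE, rule that)
  have M: "maximum_matching G M" "t \<notin> \<Union>M"
    using *(1) by simp_all
  have best: "card (M' \<inter> N) \<le> card (M \<inter> N)" if "maximum_matching G M'" "t \<notin> \<Union>M'" for M'
    using *(2) that by simp
  have mM: "matching G M" and mN: "matching G N" and cMN: "card M = card N"
    using M N by (auto simp: maximum_matching_def)
  have fM: "finite M" using G mM by (rule finite_matching)
  note fu = card_Union_matching[OF G mM] card_Union_matching[OF G mN]
  \<comment> \<open>\<open>M\<close> and \<open>N\<close> cover equally many vertices, so
    \<open>u\<close> and \<open>v\<close>, covered by \<open>M\<close> alone, are offset by at least
    two vertices covered by \<open>N\<close> alone; one of these differs from
    \<open>t\<close>.\<close>
  have "{u, v} \<subseteq> \<Union>M - \<Union>N" using cov[OF M] N by blast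
  then have "card {u, v} \<le> card (\<Union>M - \<Union>N)" using fu by (intro card_mono) auto
  also have "\<dots> \<le> card (\<Union>N - \<Union>M)"
    using fu cMN by (intro card_le_sym_Diff) auto
  finally have "2 \<le> card (\<Union>N - \<Union>M)" using N by simp
  moreover have "card (\<Union>N - \<Union>M) \<le> 1" if "\<Union>N - \<Union>M \<subseteq> {t}"
    using card_mono[OF _ that] by simp
  ultimately obtain x where x: "x \<in> \<Union>N" "x \<notin> \<Union>M" "x \<noteq> t" by fastforce
  then obtain e where e: "e \<in> N" "x \<in> e" by blast
  have eE: "e \<in> edges G" using e mN by (auto simp: matching_def)
  obtain y where y: "e = {x, y}" "x \<noteq> y" using edge_cases[OF G eE e(2)] by blast
  have "y \<in> \<Union>M" using maximum_matching_covers_edge[OF G M(1), of x y] eE y x by blast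
  then obtain f where f: "f \<in> M" "y \<in> f" by blast
  have yg: "y \<notin> g" if "g \<in> M - {f}" for g
    using matching_edges_eq[OF mM f(1) _ f(2)] that by blast
  \<comment> \<open>If \<open>f\<close> were in \<open>N\<close>, it would share \<open>y\<close>
    with \<open>e\<close> and thus equal \<open>e\<close>, although \<open>M\<close> misses
    \<open>x\<close>.\<close>
  have fN': "f \<notin> N"
    using matching_edges_eq[OF mN _ e(1) f(2)] f e y x by blast
  have "e \<notin> M" using e x by blast
  \<comment> \<open>Trading \<open>f\<close> for \<open>e\<close> keeps the size and still avoids
    \<open>t\<close>: \<open>x\<close> differs from \<open>t\<close> by choice, and \<open>y\<close>
    does because \<open>M\<close> covers \<open>y\<close> but not \<open>t\<close>. The gain is the
    common edge \<open>e\<close>.\<close>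
  define M' where "M' = insert e (M - {f})"
  have "matching G (M - {f})" using mM by (auto simp: matching_def pairwise_def)
  then have "matching G M'" unfolding M'_def
    by (rule matching_insert) (use eE y x yg in auto)
  moreover have "card M' = card M"
    using \<open>e \<notin> M\<close> f(1) fM card_Suc_Diff1[OF fM f(1)] by (simp add: M'_def)
  ultimately have "maximum_matching G M'" using M by (simp add: maximum_matching_def)
  moreover have "t \<notin> \<Union>M'" using M(2) x y \<open>y \<in> \<Union>M\<close> by (auto simp: M'_def)
  ultimately have "card (M' \<inter> N) \<le> card (M \<inter> N)" by (rule best)
  moreover have "M' \<inter> N = insert e (M \<inter> N)" using fN' e by (auto simp: M'_def)
  ultimately show False using \<open>e \<notin> M\<close> fM by simp
qed

text \<open>Induction along a walk from \<open>u\<close>. If some \<open>N\<close> missed both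
  \<open>u\<close> and the new vertex \<open>z\<close>, the exchange lemma would apply with the
  previous vertex \<open>y\<close> as \<open>t\<close>: a maximum matching missing \<open>y\<close>
  covers \<open>u\<close> by the induction hypothesis and covers \<open>z\<close> because of the
  edge \<open>{y, z}\<close>.\<close>

lemma gallai:
  assumes G: "finite_simple_graph G"
    and missed: "\<And>v. v \<in> verts G \<Longrightarrow> \<exists>M. maximum_matching G M \<and> v \<notin> \<Union>M"
    and "(u, v) \<in> (adj_rel G)\<^sup>*" "u \<noteq> v" "maximum_matching G N" "u \<notin> \<Union>N"
  shows "v \<in> \<Union>N"
proof -
  \<comment> \<open>The claim is quantified over all maximum matchings because the induction
    hypothesis is applied to matchings other than the given \<open>N\<close>; the disjunct
    \<open>u = v\<close> takes care of the trivial walk and of walks returning to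
    \<open>u\<close>.\<close>
  have "u = v \<or> (\<forall>N. maximum_matching G N \<longrightarrow> u \<notin> \<Union>N \<longrightarrow> v \<in> \<Union>N)"
    using assms(3)
  proof (induction rule: rtrancl_induct)
    case base
    then show ?case by simp
  next
    case (step y z)
    have e: "{y, z} \<in> edges G" using step(2) by (simp add: adj_rel_def)
    then have "y \<in> verts G" using G by (auto simp: finite_simple_graph_def)
    then obtain M0 where M0: "maximum_matching G M0" "y \<notin> \<Union>M0" using missed by blast
    show ?case
    proof (rule ccontr)
      assume "\<not> ?case"
      then have "u \<noteq> z" and "\<exists>N. maximum_matching G N \<and> u \<notin> \<Union>N \<and> z \<notin> \<Union>N" by simp_all
      from this(2) obtain N where N: "maximum_matching G N" "u \<notin> \<Union>N" "z \<notin> \<Union>N"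
        by (elim exE conjE) (rule that)
      \<comment> \<open>If \<open>u\<close> were \<open>y\<close>, then \<open>N\<close> would miss
        both ends of the edge \<open>{y, z}\<close>.\<close>
      have "u \<noteq> y" using N e maximum_matching_covers_edge[OF G N(1), of u z] by metis
      then have IH: "\<And>N. maximum_matching G N \<Longrightarrow> u \<notin> \<Union>N \<Longrightarrow> y \<in> \<Union>N"
        using step.IH by simp
      show False
      proof (rule maximum_matching_exchange[OF G N \<open>u \<noteq> z\<close> M0])
        fix M assume M: "maximum_matching G M" "y \<notin> \<Union>M"
        show "u \<in> \<Union>M \<and> z \<in> \<Union>M"
          using IH[OF M(1)] M(2) maximum_matching_covers_edge[OF G M(1) e M(2)] by metis
      qed
    qed
  qed
  then show ?thesis using assms by blast
qed

section \<open>Components\<close>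

text \<open>Names the members of \<open>components_of_graph\<close>, which turns the set of
  components into an image of the vertex set.\<close>

definition component_of :: "'a graph \<Rightarrow> 'a \<Rightarrow> 'a graph" where
  "component_of G u = induced_subgraph G {w \<in> verts G. (u, w) \<in> (adj_rel G)\<^sup>*}"

lemma components_of_graph_eq: "components_of_graph G = component_of G ` verts G"
  by (auto simp: components_of_graph_def component_of_def)

lemma verts_component_of: "verts (component_of G u) = {w \<in> verts G. (u, w) \<in> (adj_rel G)\<^sup>*}"
  by (auto simp: component_of_def induced_subgraph_def)

lemma sym_adj_rel: "sym (adj_rel G)"
  by (auto simp: adj_rel_def sym_def insert_commute)

lemma component_of_cong:
  assumes "(u, w) \<in> (adj_rel G)\<^sup>*"
  shows "component_of G u = component_of G w"
proof -
  have "(w, u) \<in> (adj_rel G)\<^sup>*" using assms sym_rtrancl[OF sym_adj_rel[of G]] by (rule symD[rotated])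
  then have "(u, z) \<in> (adj_rel G)\<^sup>* \<longleftrightarrow> (w, z) \<in> (adj_rel G)\<^sup>*" for z
    using assms by (meson rtrancl_trans)
  then show ?thesis by (simp add: component_of_def)
qed

lemma component_of_mem:
  assumes "C \<in> components_of_graph G" "v \<in> verts C"
  shows "C = component_of G v"
  using assms by (auto simp: components_of_graph_eq verts_component_of component_of_cong)

lemma component_edge:
  assumes "finite_simple_graph G" "C \<in> components_of_graph G" "e \<in> edges G" "e \<inter> verts C \<noteq> {}"
  shows "e \<subseteq> verts C"
proof -
  obtain v where v: "v \<in> e" "v \<in> verts C" using assms by blast
  obtain w where w: "e = {v, w}" "w \<in> verts G" using edge_cases[OF assms(1,3) v(1)] by metis
  then have "(v, w) \<in> (adj_rel G)\<^sup>*" using assms by (auto simp: adj_rel_def)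
  then show ?thesis using w v component_of_mem[OF assms(2) v(2)] by (auto simp: verts_component_of)
qed

text \<open>A maximum matching missing \<open>v\<close> covers all other vertices of the component
  by Gallai's lemma, and its edges meeting the component stay inside it.\<close>

lemma component_factor_critical:
  assumes G: "finite_simple_graph G"
    and missed: "\<And>v. v \<in> verts G \<Longrightarrow> \<exists>M. maximum_matching G M \<and> v \<notin> \<Union>M"
    and C: "C \<in> components_of_graph G" "v \<in> verts C"
  obtains M where "matching G M" "verts C - {v} = \<Union>M" "v \<notin> \<Union>M"
proof -
  have Cv: "C = component_of G v" using C by (rule component_of_mem)
  have "v \<in> verts G" using C by (auto simp: components_of_graph_eq verts_component_of)
  then obtain N where N: "maximum_matching G N" "v \<notin> \<Union>N" using missed by blast
  define M where "M = {e \<in> N. e \<inter> verts C \<noteq> {}}"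
  have NE: "N \<subseteq> edges G" using N by (auto simp: maximum_matching_def matching_def)
  have "matching G M"
    using N by (auto simp: M_def maximum_matching_def matching_def pairwise_def)
  moreover have "v \<notin> \<Union>M" using N by (auto simp: M_def)
  moreover have "verts C - {v} = \<Union>M"
  proof
    show "verts C - {v} \<subseteq> \<Union>M"
    proof
      fix w assume w: "w \<in> verts C - {v}"
      then have "(v, w) \<in> (adj_rel G)\<^sup>*" by (simp add: Cv verts_component_of)
      then have "w \<in> \<Union>N" using gallai[OF G missed _ _ N, of w] w by blast
      then show "w \<in> \<Union>M" using w by (auto simp: M_def)
    qed
    show "\<Union>M \<subseteq> verts C - {v}"
      using component_edge[OF G C(1)] NE N by (fastforce simp: M_def)
  qed
  ultimately show thesis by (intro that)
qed

lemma finite_verts_component: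
  assumes "finite_simple_graph G" "C \<in> components_of_graph G"
  shows "finite (verts C)" "verts C \<subseteq> verts G" "verts C \<noteq> {}"
  using assms by (auto simp: components_of_graph_eq verts_component_of finite_simple_graph_def)

text \<open>Deleting one vertex leaves a set that a matching covers exactly, hence one of even
  size.\<close>

lemma odd_component:
  assumes G: "finite_simple_graph G"
    and missed: "\<And>v. v \<in> verts G \<Longrightarrow> \<exists>M. maximum_matching G M \<and> v \<notin> \<Union>M"
    and C: "C \<in> components_of_graph G"
  shows "odd (card (verts C))"
proof -
  obtain v where v: "v \<in> verts C" using finite_verts_component[OF G C] by blast
  obtain M where M: "matching G M" "verts C - {v} = \<Union>M"
    by (rule component_factor_critical[OF G missed C v])
  have "card (verts C) = Suc (card (verts C - {v}))"
    using card_Suc_Diff1[OF _ v] finite_verts_component[OF G C] by simp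
  then show ?thesis using card_Union_matching[OF G M(1)] M(2) by simp
qed

lemma finite_components: "finite_simple_graph G \<Longrightarrow> finite (components_of_graph G)"
  by (simp add: components_of_graph_eq finite_simple_graph_def)

lemma card_verts_components:
  assumes G: "finite_simple_graph G"
  shows "card (verts G) = (\<Sum>C\<in>components_of_graph G. card (verts C))"
proof -
  have "verts G = (\<Union>C\<in>components_of_graph G. verts C)"
    by (auto simp: components_of_graph_eq verts_component_of)
  then have "card (verts G) = card (\<Union>C\<in>components_of_graph G. verts C)" by simp
  also have "\<dots> = (\<Sum>C\<in>components_of_graph G. card (verts C))"
  proof (rule card_UN_disjoint)
    show "\<forall>C\<in>components_of_graph G. \<forall>D\<in>components_of_graph G. C \<noteq> D \<longrightarrow> verts C \<inter> verts D = {}"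
      using component_of_mem[of _ G] by (metis disjoint_iff)
  qed (use finite_components[OF G] finite_verts_component[OF G] in auto)
  finally show ?thesis .
qed

text \<open>By Gallai's lemma a maximum matching misses at most one vertex of each
  component.\<close>

lemma card_verts_le_components:
  assumes G: "finite_simple_graph G"
    and missed: "\<And>v. v \<in> verts G \<Longrightarrow> \<exists>M. maximum_matching G M \<and> v \<notin> \<Union>M"
  shows "card (verts G) \<le> 2 * matching_number G + card (components_of_graph G)"
proof -
  obtain N where N: "maximum_matching G N" using maximum_matching_exists[OF G] .
  then have mN: "matching G N" and cN: "card N = matching_number G"
    by (auto simp: maximum_matching_def)
  have "inj_on (component_of G) (verts G - \<Union>N)"
  proof (rule inj_onI)
    fix u v assume uv: "u \<in> verts G - \<Union>N" "v \<in> verts G - \<Union>N" "component_of G u = component_of G v"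
    have "v \<in> verts (component_of G u)" using uv by (simp add: verts_component_of)
    then have "(u, v) \<in> (adj_rel G)\<^sup>*" by (simp add: verts_component_of)
    then show "u = v" using gallai[OF G missed _ _ N, of u v] uv by blast
  qed
  then have "card (verts G - \<Union>N) \<le> card (components_of_graph G)"
    using finite_components[OF G] by (intro card_inj_on_le) (auto simp: components_of_graph_eq)
  moreover have "card (verts G) - card (\<Union>N) \<le> card (verts G - \<Union>N)"
    by (rule diff_card_le_card_Diff) (use card_Union_matching[OF G mN] in auto)
  ultimately show ?thesis using card_Union_matching[OF G mN] cN by simp
qed

lemma connected_components:
  assumes "finite_simple_graph G" "connected_graph G"
  shows "components_of_graph G = {G}"
proof -
  have "component_of G u = G" if "u \<in> verts G" for u
  proof -
    have "{w \<in> verts G. (u, w) \<in> (adj_rel G)\<^sup>*} = verts G"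
      using assms that by (auto simp: connected_graph_def)
    moreover have "{e \<in> edges G. e \<subseteq> verts G} = edges G"
      using assms(1) by (auto simp: finite_simple_graph_def)
    ultimately show ?thesis by (simp add: component_of_def induced_subgraph_def)
  qed
  then show ?thesis using assms by (auto simp: components_of_graph_eq connected_graph_def)
qed

section \<open>The vertex set to delete\<close>

lemma finite_simple_induced_subgraph:
  "finite_simple_graph G \<Longrightarrow> finite_simple_graph (induced_subgraph G W)"
  by (auto simp: finite_simple_graph_def induced_subgraph_def)

lemma induced_subgraph_verts:
  "finite_simple_graph G \<Longrightarrow> induced_subgraph G (verts G) = G"
  by (cases G) (auto simp: induced_subgraph_def finite_simple_graph_def)

text \<open>Dropping the edge at \<open>v\<close> from a maximum matching loses only one edge;
  conversely, a maximum matching of the smaller graph misses \<open>v\<close>, so it is not maximum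
  in the larger one.\<close>

lemma matching_number_delete_vertex:
  assumes G: "finite_simple_graph G"
    and cov: "\<And>M. maximum_matching (induced_subgraph G W) M \<Longrightarrow> v \<in> \<Union>M"
  shows "matching_number (induced_subgraph G W) =
    Suc (matching_number (induced_subgraph G (W - {v})))"
proof -
  let ?H = "induced_subgraph G W" and ?H' = "induced_subgraph G (W - {v})"
  note H = finite_simple_induced_subgraph[OF G]
  obtain M where M: "maximum_matching ?H M" using maximum_matching_exists[OF H] .
  then have mM: "matching ?H M" by (simp add: maximum_matching_def)
  obtain f where f: "f \<in> M" "v \<in> f" using cov[OF M] by blast
  have "v \<notin> e" if "e \<in> M - {f}" for e
    using matching_edges_eq[OF mM _ f(1) _ f(2)] that by blast
  then have "matching ?H' (M - {f})"
    using mM by (auto simp: matching_def pairwise_def induced_subgraph_def)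
  then have "card (M - {f}) \<le> matching_number ?H'" by (rule card_matching_le[OF H])
  then have 1: "matching_number ?H \<le> Suc (matching_number ?H')"
    using M f finite_matching[OF H mM] by (simp add: maximum_matching_def)
  obtain M' where M': "maximum_matching ?H' M'" using maximum_matching_exists[OF H] .
  then have mM': "matching ?H M'"
    by (auto simp: maximum_matching_def matching_def induced_subgraph_def)
  have "v \<notin> \<Union>M'"
    using M' by (auto simp: maximum_matching_def matching_def induced_subgraph_def)
  then have "\<not> maximum_matching ?H M'" using cov by blast
  then have "matching_number ?H' < matching_number ?H"
    using card_matching_le[OF H mM'] M' mM' by (auto simp: maximum_matching_def)
  then show ?thesis using 1 by simp
qed

text \<open>Taken of maximum size, \<open>S\<close> cannot be enlarged, whereas a remaining vertex
  covered by every maximum matching could be added to it by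
  \<open>matching_number_delete_vertex\<close>.\<close>

lemma gallai_edmonds_set:
  assumes G: "finite_simple_graph G"
  shows "\<exists>S\<subseteq>verts G.
    matching_number G = matching_number (induced_subgraph G (verts G - S)) + card S \<and>
    (\<forall>v\<in>verts G - S. \<exists>M. maximum_matching (induced_subgraph G (verts G - S)) M \<and> v \<notin> \<Union>M)"
proof -
  let ?H = "\<lambda>S. induced_subgraph G (verts G - S)"
  let ?P = "\<lambda>S. S \<subseteq> verts G \<and> matching_number G = matching_number (?H S) + card S"
  have fin: "finite (verts G)" using G by (simp add: finite_simple_graph_def)
  have "\<exists>S. ?P S \<and> (\<forall>T. ?P T \<longrightarrow> card T \<le> card S)"
  proof (rule ex_has_greatest_nat)
    show "?P {}"
      using induced_subgraph_verts[OF G] by simp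
    show "\<forall>S. ?P S \<longrightarrow> card S < Suc (card (verts G))"
      using fin by (simp add: card_mono less_Suc_eq_le)
  qed
  then obtain S where S: "?P S" and max: "\<And>T. ?P T \<Longrightarrow> card T \<le> card S" by blast
  have "\<exists>M. maximum_matching (?H S) M \<and> v \<notin> \<Union>M" if v: "v \<in> verts G - S" for v
  proof (rule ccontr)
    assume "\<not> ?thesis"
    then have eq: "matching_number (?H S) =
        Suc (matching_number (induced_subgraph G (verts G - S - {v})))"
      by (intro matching_number_delete_vertex[OF G]) auto
    have "verts G - S - {v} = verts G - insert v S" by blast
    moreover have cS: "card (insert v S) = Suc (card S)"
      using v S fin finite_subset[of S "verts G"] by simp
    ultimately have "?P (insert v S)" using S v eq by auto
    then show False using max[of "insert v S"] cS by simp
  qed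
  then show ?thesis using S by blast
qed

section \<open>Weak duality\<close>

text \<open>Here \<open>y\<close> is a fractional vertex cover. Multiply the weight of each edge by
  the cover it receives, exchange the two sums, and use the matching constraint at each
  vertex.\<close>

lemma fractional_matching_size_le_cover:
  assumes G: "finite_simple_graph G" and \<phi>: "fractional_matching G \<phi>"
    and y: "\<And>v. v \<in> verts G \<Longrightarrow> (0::real) \<le> y v" "\<And>e. e \<in> edges G \<Longrightarrow> 1 \<le> (\<Sum>v\<in>e. y v)"
  shows "fractional_matching_size G \<phi> \<le> (\<Sum>v\<in>verts G. y v)"
proof -
  have fin: "finite (verts G)" "finite (edges G)"
    using G finite_edges by (auto simp: finite_simple_graph_def)
  have pos: "0 \<le> \<phi> e" if "e \<in> edges G" for e
    using \<phi> that by (auto simp: fractional_matching_def Pi_def)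
  have "fractional_matching_size G \<phi> \<le> (\<Sum>e\<in>edges G. \<phi> e * (\<Sum>v\<in>e. y v))"
    unfolding fractional_matching_size_def
    using mult_left_mono[OF y(2) pos] by (intro sum_mono) simp
  also have "\<dots> = (\<Sum>e\<in>edges G. \<Sum>v\<in>{v \<in> verts G. v \<in> e}. \<phi> e * y v)"
    using G by (intro sum.cong) (auto simp: finite_simple_graph_def sum_distrib_left intro!: sum.cong)
  also have "\<dots> = (\<Sum>v\<in>verts G. \<Sum>e\<in>{e \<in> edges G. v \<in> e}. \<phi> e * y v)"
    using fin by (intro sum.swap_restrict) auto
  also have "\<dots> = (\<Sum>v\<in>verts G. (\<Sum>e\<in>{e \<in> edges G. v \<in> e}. \<phi> e) * y v)"
    by (simp add: sum_distrib_right)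
  also have "\<dots> \<le> (\<Sum>v\<in>verts G. y v)"
  proof (rule sum_mono)
    fix v assume v: "v \<in> verts G"
    then have "(\<Sum>e\<in>{e \<in> edges G. v \<in> e}. \<phi> e) \<le> 1" using \<phi> by (simp add: fractional_matching_def)
    then show "(\<Sum>e\<in>{e \<in> edges G. v \<in> e}. \<phi> e) * y v \<le> y v"
      using mult_right_mono[OF _ y(1)[OF v]] by fastforce
  qed
  finally show ?thesis .
qed

text \<open>The cover with weight 1 on \<open>S\<close>, 0 on \<open>I\<close> and 1/2 elsewhere has
  half of the right-hand side as its total.\<close>

lemma fractional_matching_number_le:
  assumes G: "finite_simple_graph G" and S: "S \<subseteq> verts G" and I: "I \<subseteq> verts G - S"
    and iso: "\<And>e. e \<in> edges G \<Longrightarrow> e \<inter> I \<noteq> {} \<Longrightarrow> e \<inter> S \<noteq> {}"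
  shows "2 * fractional_matching_number G \<le> real (card (verts G)) + real (card S) - real (card I)"
proof -
  obtain \<phi> where \<phi>: "fractional_matching G \<phi>"
    "fractional_matching_size G \<phi> = fractional_matching_number G"
    using fractional_matching_number_attained[OF G] by blast
  have fin: "finite (verts G)" using G by (simp add: finite_simple_graph_def)
  define y :: "'a \<Rightarrow> real"
    where "y v = 1/2 + (if v \<in> S then 1/2 else 0) - (if v \<in> I then 1/2 else 0)" for v
  have "fractional_matching_number G \<le> (\<Sum>v\<in>verts G. y v)"
    unfolding \<phi>(2)[symmetric]
  proof (rule fractional_matching_size_le_cover[OF G \<phi>(1)])
    show "0 \<le> y v" for v by (simp add: y_def)
    fix e assume e: "e \<in> edges G"
    have "card e = 2" using G e by (auto simp: finite_simple_graph_def)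
    then obtain a b where ab: "e = {a, b}" "a \<noteq> b" by (auto simp: card_2_iff)
    \<comment> \<open>An edge with an end in \<open>I\<close> has its other end in \<open>S\<close>,
      which gives 0 + 1; any other edge has two weights of at least 1/2.\<close>
    have "1 \<le> y a + y b"
      using iso[OF e] I ab by (auto simp: y_def)
    then show "1 \<le> (\<Sum>v\<in>e. y v)" using ab by simp
  qed
  moreover have "(\<Sum>v\<in>verts G. y v) =
      real (card (verts G)) / 2 + (\<Sum>v\<in>verts G. if v \<in> S then 1/2 else 0) -
      (\<Sum>v\<in>verts G. if v \<in> I then 1/2 else 0)"
    by (simp add: y_def sum.distrib sum_subtractf)
  moreover have half: "(\<Sum>v\<in>verts G. if v \<in> T then 1/2 else 0) = real (card T) / 2" if "T \<subseteq> verts G" for T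
    using that fin by (simp add: sum.If_cases Int_absorb1 flip: Int_def Collect_mem_eq)
  moreover have "I \<subseteq> verts G" using I by blast
  ultimately show ?thesis using half[OF S] half[of I] by simp
qed

section \<open>Copies of small graphs\<close>

text \<open>The image of \<open>H\<close> under \<open>g\<close> is the subgraph sought. The
  definition of \<open>graph_isomorphic\<close> asks for a map from the subgraph to
  \<open>H\<close>, hence the inverse of \<open>g\<close>.\<close>

lemma contains_copyI:
  assumes "finite_simple_graph H" "inj_on g (verts H)" "g ` verts H \<subseteq> verts G"
    "\<And>e. e \<in> edges H \<Longrightarrow> g ` e \<in> edges G"
  shows "contains_copy G H"
proof -
  define S where "S = \<lparr>verts = g ` verts H, edges = (\<lambda>e. g ` e) ` edges H\<rparr>"
  have sub: "e \<subseteq> verts H" "card e = 2" if "e \<in> edges H" for e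
    using assms(1) that by (auto simp: finite_simple_graph_def)
  have "is_subgraph S G"
    unfolding is_subgraph_def finite_simple_graph_def S_def
  proof (intro conjI ballI)
    fix d assume "d \<in> edges \<lparr>verts = g ` verts H, edges = (\<lambda>e. g ` e) ` edges H\<rparr>"
    then obtain e where e: "e \<in> edges H" "d = g ` e" by auto
    then show "d \<subseteq> verts \<lparr>verts = g ` verts H, edges = (\<lambda>e. g ` e) ` edges H\<rparr>"
      using sub[OF e(1)] by auto
    show "card d = 2" using e sub[OF e(1)] assms(2) by (metis card_image inj_on_subset)
  qed (use assms in \<open>auto simp: finite_simple_graph_def\<close>)
  moreover have "graph_isomorphic S H"
    unfolding graph_isomorphic_def
  proof (intro exI conjI)
    let ?f = "inv_into (verts H) g"
    show "bij_betw ?f (verts S) (verts H)"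
      unfolding S_def using assms(2) by (simp add: bij_betw_inv_into inj_on_imp_bij_betw)
    have "?f ` g ` e = e" if "e \<in> edges H" for e
      using sub[OF that] assms(2) by (simp add: inv_into_image_cancel)
    then show "edges H = (\<lambda>e. ?f ` e) ` edges S"
      by (simp add: S_def image_image)
  qed
  ultimately show ?thesis by (auto simp: contains_copy_def)
qed

text \<open>All pairs are edges, so any bijection of the vertex sets is an isomorphism.\<close>

lemma isomorphic_complete_graph:
  assumes "finite (verts C)" "card (verts C) = k" "edges C = {e. e \<subseteq> verts C \<and> card e = 2}"
  shows "graph_isomorphic C (complete_graph k)"
proof -
  obtain f where f: "bij_betw f (verts C) {..<k}"
    using assms finite_same_card_bij[of "verts C" "{..<k}"] by auto
  then have inj: "inj_on f (verts C)" and im: "f ` verts C = {..<k}" by (auto simp: bij_betw_def)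
  have "{e. e \<subseteq> {..<k} \<and> card e = 2} = (\<lambda>e. f ` e) ` {e. e \<subseteq> verts C \<and> card e = 2}"
  proof (intro equalityI subsetI)
    fix e assume e: "e \<in> {e. e \<subseteq> {..<k} \<and> card e = 2}"
    then obtain d where "d \<subseteq> verts C" "e = f ` d" 
      using im by (metis (no_types, lifting) mem_Collect_eq subset_imageE)
    then show "e \<in> (\<lambda>e. f ` e) ` {e. e \<subseteq> verts C \<and> card e = 2}"
      using e inj by (auto simp: card_image inj_on_subset)
  qed (use im inj in \<open>auto simp: card_image inj_on_subset\<close>)
  then show ?thesis
    using f assms(3) by (auto simp: graph_isomorphic_def complete_graph_def)
qed

lemma contains_cycle5:
  assumes "distinct [a, b, c, d, e]" "set [a, b, c, d, e] \<subseteq> verts G"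
    "{a, b} \<in> edges G" "{b, c} \<in> edges G" "{c, d} \<in> edges G" "{d, e} \<in> edges G" "{e, a} \<in> edges G"
  shows "contains_copy G (cycle_graph 5)"
proof -
  have 5: "{..<5::nat} = {0, 1, 2, 3, 4}" by auto
  have E: "edges (cycle_graph 5) = {{0,1},{1,2},{2,3},{3,4},{4,0}}"
  proof -
    have "edges (cycle_graph 5) = (\<lambda>i. {i, (i + 1) mod 5}) ` {..<5}"
      by (auto simp: cycle_graph_def)
    then show ?thesis unfolding 5 by (simp add: numeral_2_eq_2)
  qed
  have V: "verts (cycle_graph 5) = {0, 1, 2, 3, 4}" using 5 by (simp add: cycle_graph_def)
  show ?thesis
  proof (rule contains_copyI[where g = "\<lambda>i. [a, b, c, d, e] ! i"])
    show "finite_simple_graph (cycle_graph 5)" by (auto simp: finite_simple_graph_def E V)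
    show "inj_on ((!) [a, b, c, d, e]) (verts (cycle_graph 5))"
      using assms(1) by (auto simp: V inj_on_def)
    show "(!) [a, b, c, d, e] ` verts (cycle_graph 5) \<subseteq> verts G" using assms(2) by (auto simp: V)
    show "(!) [a, b, c, d, e] ` x \<in> edges G" if "x \<in> edges (cycle_graph 5)" for x
      using that assms(3-) by (auto simp: E)
  qed
qed

lemma card_2_subsets:
  assumes "e \<subseteq> {a, b, c}" "card e = 2"
  shows "e = {a, b} \<or> e = {a, c} \<or> e = {b, c}"
  using assms by (auto simp: card_2_iff)

lemma contains_K2_K3:
  assumes "distinct [a, b, c, d, e]" "set [a, b, c, d, e] \<subseteq> verts G"
    "{a, b} \<in> edges G" "{c, d} \<in> edges G" "{d, e} \<in> edges G" "{c, e} \<in> edges G"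
  shows "contains_copy G (disjoint_union_graph (complete_graph 2) (complete_graph 3))"
    (is "contains_copy G ?K")
proof -
  have 2: "{..<2::nat} = {0, 1}" and 3: "{..<3::nat} = {0, 1, 2}" by auto
  have sub2: "e = {0, 1}" if "e \<subseteq> {0, 1}" "card e = 2" for e :: "nat set"
    using card_subset_eq[OF _ that(1)] that(2) by simp
  have E2: "edges (complete_graph 2) = {{0, 1}}"
  proof (intro equalityI subsetI)
    fix e assume "e \<in> edges (complete_graph 2)"
    then show "e \<in> {{0, 1}}" unfolding complete_graph_def 2 using sub2[of e] by simp
  qed (auto simp: complete_graph_def)
  have E3: "edges (complete_graph 3) = {{0, 1}, {0, 2}, {1, 2}}"
  proof (intro equalityI subsetI)
    fix e assume "e \<in> edges (complete_graph 3)"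
    then show "e \<in> {{0, 1}, {0, 2}, {1, 2}}"
      unfolding complete_graph_def 3 using card_2_subsets[of e 0 1 2] by simp
  qed (auto simp: complete_graph_def)
  have E: "edges ?K = {{Inl 0, Inl 1}, {Inr 0, Inr 1}, {Inr 0, Inr 2}, {Inr 1, Inr 2}}"
    unfolding disjoint_union_graph_def E2 E3 by auto
  have V: "verts ?K = {Inl 0, Inl 1, Inr 0, Inr 1, Inr 2}"
    by (auto simp: disjoint_union_graph_def complete_graph_def 2 3)
  show ?thesis
  proof (rule contains_copyI[where g = "case_sum (\<lambda>i. [a, b] ! i) (\<lambda>i. [c, d, e] ! i)"])
    show "finite_simple_graph ?K" by (auto simp: finite_simple_graph_def E V)
  qed (use assms in \<open>auto simp: E V inj_on_def\<close>)
qed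

section \<open>Factor-critical graphs on five and three vertices\<close>

text \<open>The partner of \<open>p\<close> is one of the three other vertices, and the two vertices
  left over must then be partners of each other.\<close>

lemma matching_cover_4:
  assumes G: "finite_simple_graph G" and M: "matching G M" "\<Union>M = {p, q, r, s}"
    and d: "distinct [p, q, r, s]"
  shows "{p, q} \<in> edges G \<and> {r, s} \<in> edges G \<or> {p, r} \<in> edges G \<and> {q, s} \<in> edges G \<or>
    {p, s} \<in> edges G \<and> {q, r} \<in> edges G"
proof -
  have ME: "M \<subseteq> edges G" using M by (simp add: matching_def)
  have partner: "\<exists>y. {x, y} \<in> M \<and> y \<noteq> x \<and> y \<in> \<Union>M" if x: "x \<in> \<Union>M" for x
  proof -
    obtain e where e: "e \<in> M" "x \<in> e" using x by blast
    then obtain y where "e = {x, y}" "x \<noteq> y" using edge_cases[OF G _ e(2)] ME by blast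
    then show ?thesis using e by blast
  qed
  \<comment> \<open>The partner of \<open>c\<close> cannot lie on the edge \<open>{a, b}\<close>,
    since matching edges through a common vertex coincide; only \<open>d\<close> remains.\<close>
  have other: "{c, d} \<in> M" if ab: "{a, b} \<in> M" and U: "\<Union>M = {a, b, c, d}" and dist: "distinct [a, b, c, d]" for a b c d
  proof -
    have "c \<in> \<Union>M" using U by simp
    from partner[OF this] obtain y where y: "{c, y} \<in> M" "y \<noteq> c" "y \<in> \<Union>M" by blast
    have "{c, y} \<noteq> {a, b}" using dist by auto
    then have "y \<notin> {a, b}" using matching_edges_eq[OF M(1) y(1) ab, of y] by blast
    then show ?thesis using y U by auto
  qed
  have "p \<in> \<Union>M" using M(2) by simp
  from partner[OF this] obtain y where y: "{p, y} \<in> M" "y \<noteq> p" "y \<in> \<Union>M" by blast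
  then consider "{p, q} \<in> M" | "{p, r} \<in> M" | "{p, s} \<in> M" unfolding M(2) by auto
  then show ?thesis
  proof cases
    case 1
    then have "{r, s} \<in> M" using other[of p q r s] M(2) d by simp
    then show ?thesis using 1 ME by blast
  next
    case 2
    then have "{q, s} \<in> M" using M(2) d by (intro other[of p r q s]) auto
    then show ?thesis using 2 ME by blast
  next
    case 3
    then have "{q, r} \<in> M" using M(2) d by (intro other[of p s q r]) auto
    then show ?thesis using 3 ME by blast
  qed
qed

text \<open>Deleting \<open>a\<close> gives, up to renaming, the edges \<open>{b, c}\<close> and
  \<open>{d, e}\<close>. Deleting only \<open>b\<close>, and likewise only \<open>c\<close>, leaves
  a few possibilities for further edges, and each combination completes a 5-cycle or a triangle with
  a disjoint edge.\<close>

lemma factor_critical_5: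
  assumes G: "finite_simple_graph G" and 5: "card (verts G) = 5"
    and fc: "\<And>v. v \<in> verts G \<Longrightarrow> \<exists>M. matching G M \<and> verts G - {v} = \<Union>M"
  shows "contains_copy G (cycle_graph 5) \<or>
    contains_copy G (disjoint_union_graph (complete_graph 2) (complete_graph 3))"
proof -
  obtain xs where xs: "distinct xs" "set xs = verts G" "length xs = 5"
    using finite_distinct_list[of "verts G"] G 5 distinct_card unfolding finite_simple_graph_def by metis
  then obtain a p q r s where "xs = [a, p, q, r, s]"
    by (auto simp: numeral_eq_Suc length_Suc_conv)
  then have V: "verts G = {a, p, q, r, s}" and d: "distinct [a, p, q, r, s]" using xs by auto
  have three: "{w, x} \<in> edges G \<and> {y, z} \<in> edges G \<or> {w, y} \<in> edges G \<and> {x, z} \<in> edges G \<or>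
      {w, z} \<in> edges G \<and> {x, y} \<in> edges G"
    if V: "verts G = {v, w, x, y, z}" and d: "distinct [v, w, x, y, z]" for v w x y z
  proof -
    have "v \<in> verts G" using V by simp
    from fc[OF this] obtain M where "matching G M \<and> verts G - {v} = \<Union>M" by (rule exE)
    then have "matching G M" "\<Union>M = verts G - {v}" by (rule conjunct1, simp)
    then show ?thesis using V d by (intro matching_cover_4[OF G, of M]) auto
  qed
  have main: ?thesis
    if V: "verts G = {a, b, c, d, e}" and dist: "distinct [a, b, c, d, e]"
      and bc: "{b, c} \<in> edges G" and de: "{d, e} \<in> edges G" for b c d e
  proof -
    have cyc: ?thesis if "distinct [t, u, v, w, x]" "set [t, u, v, w, x] = verts G"
      "{t, u} \<in> edges G" "{u, v} \<in> edges G" "{v, w} \<in> edges G" "{w, x} \<in> edges G" "{x, t} \<in> edges G"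
      for t u v w x using contains_cycle5[of t u v w x G] that by blast
    have tri: ?thesis if "distinct [t, u, v, w, x]" "set [t, u, v, w, x] = verts G"
      "{t, u} \<in> edges G" "{v, w} \<in> edges G" "{w, x} \<in> edges G" "{v, x} \<in> edges G"
      for t u v w x using contains_K2_K3[of t u v w x G] that by blast
    note sw = insert_commute
    have B: "{a, c} \<in> edges G \<and> {d, e} \<in> edges G \<or> {a, d} \<in> edges G \<and> {c, e} \<in> edges G \<or>
      {a, e} \<in> edges G \<and> {c, d} \<in> edges G"
      using three[of b a c d e] V dist by auto
    have C: "{a, b} \<in> edges G \<and> {d, e} \<in> edges G \<or> {a, d} \<in> edges G \<and> {b, e} \<in> edges G \<or>
      {a, e} \<in> edges G \<and> {b, d} \<in> edges G"
      using three[of c a b d e] V dist by auto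
    \<comment> \<open>There are nine combinations of the alternatives in \<open>B\<close> and
      \<open>C\<close>. The last case merges two of them, in which \<open>a\<close> is joined to
      \<open>d\<close> by one alternative and to \<open>e\<close> by the other, so that
      \<open>a\<close>, \<open>d\<close>, \<open>e\<close> form a triangle.\<close>
    consider "{a, c} \<in> edges G" "{a, b} \<in> edges G"
      | "{a, c} \<in> edges G" "{a, d} \<in> edges G" "{b, e} \<in> edges G"
      | "{a, c} \<in> edges G" "{a, e} \<in> edges G" "{b, d} \<in> edges G"
      | "{a, b} \<in> edges G" "{a, d} \<in> edges G" "{c, e} \<in> edges G"
      | "{a, b} \<in> edges G" "{a, e} \<in> edges G" "{c, d} \<in> edges G"
      | "{a, d} \<in> edges G" "{c, e} \<in> edges G" "{b, e} \<in> edges G"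
      | "{a, e} \<in> edges G" "{c, d} \<in> edges G" "{b, d} \<in> edges G"
      | "{a, d} \<in> edges G" "{a, e} \<in> edges G"
      using B C by blast
    then show ?thesis
    proof cases
      case 1 show ?thesis by (rule tri[of d e a b c]) (use 1 V dist bc de in auto)
    next
      case 2 show ?thesis by (rule cyc[of a d e b c]) (use 2 V dist bc de in \<open>auto simp: sw\<close>)
    next
      case 3 show ?thesis by (rule cyc[of a e d b c]) (use 3 V dist bc de in \<open>auto simp: sw\<close>)
    next
      case 4 show ?thesis by (rule cyc[of a d e c b]) (use 4 V dist bc de in \<open>auto simp: sw\<close>)
    next
      case 5 show ?thesis by (rule cyc[of a e d c b]) (use 5 V dist bc de in \<open>auto simp: sw\<close>)
    next
      case 6 show ?thesis by (rule tri[of a d b c e]) (use 6 V dist bc de in auto)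
    next
      case 7 show ?thesis by (rule tri[of a e b c d]) (use 7 V dist bc de in auto)
    next
      case 8 show ?thesis by (rule tri[of b c a d e]) (use 8 V dist bc de in auto)
    qed
  qed
  \<comment> \<open>The three possible perfect matchings on the vertices other than \<open>a\<close>
    differ only by a renaming.\<close>
  from three[OF V d] consider "{p, q} \<in> edges G" "{r, s} \<in> edges G"
    | "{p, r} \<in> edges G" "{q, s} \<in> edges G" | "{p, s} \<in> edges G" "{q, r} \<in> edges G" by blast
  then show ?thesis
  proof cases
    case 1 show ?thesis by (rule main[of p q r s]) (use 1 V d in auto)
  next
    case 2 show ?thesis by (rule main[of p r q s]) (use 2 V d in auto)
  next
    case 3 show ?thesis by (rule main[of p s q r]) (use 3 V d in auto)
  qed
qed

text \<open>A pair \<open>e\<close> of vertices of \<open>C\<close> omits one vertex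
  \<open>v\<close>. A matching that covers exactly the rest of \<open>C\<close> covers just
  \<open>e\<close>, so it has \<open>e\<close> as an edge.\<close>

lemma factor_critical_3:
  assumes G: "finite_simple_graph G" and C: "C \<in> components_of_graph G" "card (verts C) = 3"
    and fc: "\<And>v. v \<in> verts C \<Longrightarrow> \<exists>M. matching G M \<and> verts C - {v} = \<Union>M"
  shows "graph_isomorphic C (complete_graph 3)"
proof (rule isomorphic_complete_graph)
  show "finite (verts C)" using finite_verts_component[OF G C(1)] by simp
  have EC: "edges C = {e \<in> edges G. e \<subseteq> verts C}"
    using C(1) by (auto simp: components_of_graph_def induced_subgraph_def)
  show "edges C = {e. e \<subseteq> verts C \<and> card e = 2}"
  proof (intro equalityI subsetI)
    fix e assume "e \<in> edges C"
    then show "e \<in> {e. e \<subseteq> verts C \<and> card e = 2}" using EC G by (auto simp: finite_simple_graph_def)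
  next
    fix e assume e: "e \<in> {e. e \<subseteq> verts C \<and> card e = 2}"
    have "card (verts C - e) = 1"
      using e C(2) \<open>finite (verts C)\<close> by (subst card_Diff_subset) (auto intro: finite_subset)
    then obtain v where v: "verts C - e = {v}" by (auto simp: card_1_singleton_iff)
    then have "v \<in> verts C" by blast
    from fc[OF this] obtain M where "matching G M \<and> verts C - {v} = \<Union>M" by (rule exE)
    then have M: "matching G M" "\<Union>M = verts C - {v}" by (rule conjunct1, simp)
    have eM: "\<Union>M = e" unfolding M(2) using v e by blast
    obtain x where "x \<in> e" using e by fastforce
    then obtain f where f: "f \<in> M" "x \<in> f" using eM by blast
    have "f \<in> edges G" "card f = 2" using f M(1) G by (auto simp: matching_def finite_simple_graph_def)
    moreover have "f \<subseteq> e" using f eM by blast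
    moreover have "finite e" using e \<open>finite (verts C)\<close> finite_subset by blast
    ultimately have "f = e" using e by (intro card_subset_eq) auto
    then show "e \<in> edges C" using EC e \<open>f \<in> edges G\<close> by simp
  qed
qed (use C in simp)

section \<open>The inequality and the cases of equality\<close>

theorem theorem6:
  fixes G :: "'a graph" and n :: nat
  assumes "n \<ge> 5"
    and "finite_simple_graph G"
    and "connected_graph G"
    and "card (verts G) = n"
  shows "fractional_matching_number G - real (matching_number G) \<le> (real n - 2) / 6 \<and>
    (fractional_matching_number G - real (matching_number G) = (real n - 2) / 6 \<longrightarrow>
      (n = 5 \<and> (contains_copy G (cycle_graph 5) \<or>
         contains_copy G (disjoint_union_graph (complete_graph 2) (complete_graph 3)))) \<or>
      (\<exists>v\<in>verts G. \<exists>C\<in>components_of_graph (delete_vertex G v).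
         graph_isomorphic C (complete_graph 1) \<and>
         (\<forall>D\<in>components_of_graph (delete_vertex G v) - {C}.
            graph_isomorphic D (complete_graph 3))))"
proof -
  note G = assms(2)
  have fin: "finite (verts G)" using G by (simp add: finite_simple_graph_def)
  obtain S where S: "S \<subseteq> verts G"
    and nu: "matching_number G = matching_number (induced_subgraph G (verts G - S)) + card S"
    and ex: "\<forall>v\<in>verts G - S. \<exists>M. maximum_matching (induced_subgraph G (verts G - S)) M \<and> v \<notin> \<Union>M"
    using gallai_edmonds_set[OF G] by (elim exE conjE) (rule that)
  define H where "H = induced_subgraph G (verts G - S)"
  have H: "finite_simple_graph H" unfolding H_def using G by (rule finite_simple_induced_subgraph)
  have VH: "verts H = verts G - S" by (auto simp: H_def induced_subgraph_def)
  have missed: "\<And>v. v \<in> verts H \<Longrightarrow> \<exists>M. maximum_matching H M \<and> v \<notin> \<Union>M"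
    unfolding VH unfolding H_def by (rule bspec[OF ex])
  have cVH: "card (verts H) + card S = n"
    using assms(4) card_Diff_subset[OF finite_subset[OF S fin] S] card_mono[OF fin S]
    by (simp add: VH)
  \<comment> \<open>Single vertices and larger components are counted separately: \<open>K1\<close>
    supplies the set \<open>I\<close> for the duality bound, and the members of \<open>K3\<close>
    have at least three vertices because their orders are odd.\<close>
  define K1 where "K1 = {C \<in> components_of_graph H. card (verts C) = 1}"
  define K3 where "K3 = {C \<in> components_of_graph H. card (verts C) \<noteq> 1}"
  have fK: "finite K1" "finite K3" using finite_components[OF H] by (auto simp: K1_def K3_def)
  have K: "components_of_graph H = K1 \<union> K3" "K1 \<inter> K3 = {}" by (auto simp: K1_def K3_def)
  then have cK: "card (components_of_graph H) = card K1 + card K3"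
    using fK by (simp add: card_Un_disjoint)
  have "card (verts H) \<le> 2 * matching_number H + card (components_of_graph H)"
    using H missed by (rule card_verts_le_components)
  \<comment> \<open>Deleting \<open>S\<close> lowers both the vertex count and the matching number
    by \<open>card S\<close>; the latter counts twice, so one \<open>card S\<close> remains on the
    left.\<close>
  then have lower: "n + card S \<le> 2 * matching_number G + card K1 + card K3"
    using cVH nu cK by (simp add: H_def)
  have K3_ge: "3 \<le> card (verts C)" if "C \<in> K3" for C
  proof -
    have C: "C \<in> components_of_graph H" "card (verts C) \<noteq> 1" using that by (auto simp: K3_def)
    then obtain k where "card (verts C) = 2 * k + 1" using odd_component[OF H missed] oddE by metis
    then show ?thesis using C(2) by simp
  qed
  have "card (verts H) = (\<Sum>C\<in>K1. card (verts C)) + (\<Sum>C\<in>K3. card (verts C))"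
    using card_verts_components[OF H] K fK by (simp add: sum.union_disjoint)
  then have cH: "card (verts H) = card K1 + (\<Sum>C\<in>K3. card (verts C))" by (simp add: K1_def)
  have "(\<Sum>C\<in>K3. 3) \<le> (\<Sum>C\<in>K3. card (verts C))" using K3_ge by (intro sum_mono) auto
  then have count: "card S + card K1 + 3 * card K3 \<le> n" using cVH cH by simp
  \<comment> \<open>The constant cover 1/2.\<close>
  have upper0: "2 * fractional_matching_number G \<le> real n"
    using fractional_matching_number_le[OF G, of "{}" "{}"] assms(4) by simp
  \<comment> \<open>The single-vertex components of \<open>H\<close> have neighbours in
    \<open>S\<close> only, so they may get weight 0 at the price of weight 1 on
    \<open>S\<close>.\<close>
  have upper1: "2 * fractional_matching_number G \<le> real n + real (card S) - real (card K1)"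
  proof -
    define I where "I = (\<Union>C\<in>K1. verts C)"
    have "card I = (\<Sum>C\<in>K1. card (verts C))"
      unfolding I_def
    proof (rule card_UN_disjoint)
      show "\<forall>C\<in>K1. \<forall>D\<in>K1. C \<noteq> D \<longrightarrow> verts C \<inter> verts D = {}"
        using component_of_mem[of _ H] K(1) by (metis UnI1 disjoint_iff)
      show "\<forall>C\<in>K1. finite (verts C)" using finite_verts_component[OF H] K(1) by blast
    qed (rule fK)
    then have cI: "card I = card K1" by (simp add: K1_def)
    have IH: "I \<subseteq> verts G - S"
      using finite_verts_component[OF H] VH by (fastforce simp: I_def K1_def)
    have "2 * fractional_matching_number G \<le> real (card (verts G)) + real (card S) - real (card I)"
    proof (rule fractional_matching_number_le[OF G S IH])
      fix e assume e: "e \<in> edges G" "e \<inter> I \<noteq> {}"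
      show "e \<inter> S \<noteq> {}"
      proof
        assume "e \<inter> S = {}"
        then have eH: "e \<in> edges H"
          using e(1) G by (auto simp: H_def induced_subgraph_def finite_simple_graph_def)
        obtain C where C: "C \<in> components_of_graph H" "card (verts C) = 1" "e \<inter> verts C \<noteq> {}"
          using e(2) by (auto simp: I_def K1_def)
        have "card e \<le> card (verts C)"
          using component_edge[OF H C(1) eH C(3)] finite_verts_component[OF H C(1)] by (simp add: card_mono)
        then show False using C H eH by (auto simp: finite_simple_graph_def)
      qed
    qed
    then show ?thesis using cI assms(4) by simp
  qed
  have fc: "\<exists>M. matching H M \<and> verts C - {v} = \<Union>M" if "C \<in> components_of_graph H" "v \<in> verts C" for C v
    by (rule component_factor_critical[OF H missed that]) (assumption, intro exI conjI)
  let ?d = "fractional_matching_number G - real (matching_number G)"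
  have lower': "real n + real (card S) \<le> 2 * real (matching_number G) + real (card K1) + real (card K3)"
    using of_nat_mono[OF lower, where 'a = real] by simp
  have count': "real (card S) + real (card K1) + 3 * real (card K3) \<le> real n"
    using of_nat_mono[OF count, where 'a = real] by simp
  \<comment> \<open>The lower bound on the matching number is subtracted from each upper bound: with
    \<open>upper1\<close> the terms in \<open>S\<close> and \<open>K1\<close> cancel, with
    \<open>upper0\<close> they remain.\<close>
  have d1: "2 * ?d \<le> real (card K3)" using lower' upper1 by simp
  have d0: "2 * ?d \<le> real (card K1) + real (card K3) - real (card S)" using lower' upper0 by simp
  show ?thesis
  proof (cases "S = {}")
    case True
    then have HG: "H = G" using induced_subgraph_verts[OF G] by (simp add: H_def)
    \<comment> \<open>As \<open>G\<close> is connected, \<open>S = {}\<close> leaves a single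
      component, so \<open>2 * ?d\<close> is at most 1, while \<open>5 <= n\<close> makes the
      claimed bound at least 1/2.\<close>
    have comp: "components_of_graph H = {G}" using connected_components[OF G assms(3)] HG by simp
    then have d: "2 * ?d \<le> 1" using d0 True cK by simp
    have n: "5 \<le> real n" using assms(1) by simp
    have fcG: "\<exists>M. matching G M \<and> verts G - {v} = \<Union>M" if "v \<in> verts G" for v
      using fc[of G v] that unfolding comp unfolding HG by simp
    show ?thesis
    proof (intro conjI impI)
      show "?d \<le> (real n - 2) / 6" using d n by argo
      assume "?d = (real n - 2) / 6"
      then have "real n \<le> 5" using d by argo
      then have "n = 5" using assms(1) by simp
      moreover from this have "contains_copy G (cycle_graph 5) \<or>
        contains_copy G (disjoint_union_graph (complete_graph 2) (complete_graph 3))"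
        using assms(4) by (intro factor_critical_5[OF G _ fcG]) simp_all
      ultimately show "(n = 5 \<and> (contains_copy G (cycle_graph 5) \<or>
         contains_copy G (disjoint_union_graph (complete_graph 2) (complete_graph 3)))) \<or>
        (\<exists>v\<in>verts G. \<exists>C\<in>components_of_graph (delete_vertex G v).
         graph_isomorphic C (complete_graph 1) \<and>
         (\<forall>D\<in>components_of_graph (delete_vertex G v) - {C}.
            graph_isomorphic D (complete_graph 3)))" by blast
    qed
  next
    case False
    then have s1: "1 \<le> card S" using S fin finite_subset by (fastforce simp: Suc_le_eq card_gt_0_iff)
    \<comment> \<open>Combining \<open>d1\<close> with \<open>count'\<close> works once
      \<open>card S + card K1\<close> is at least 2. In the exceptional case \<open>d0\<close> gives
      \<open>2 * ?d <= card K3 - 1\<close>, while \<open>count'\<close> gives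
      \<open>(n - 2) / 3 >= card K3 - 1/3\<close>, so the inequality is strict.\<close>
    consider (small) "card S = 1" "card K1 = 0" | (big) "2 \<le> card S + card K1" using s1 by linarith
    then show ?thesis
    proof cases
      case small
      then have "?d < (real n - 2) / 6" using d0 count' by simp
      then show ?thesis by simp
    next
      case big
      then have big': "2 \<le> real (card S) + real (card K1)" by simp
      show ?thesis
      proof (intro conjI impI disjI2)
        show "?d \<le> (real n - 2) / 6" using d1 count' big' by argo
        assume eq: "?d = (real n - 2) / 6"
        \<comment> \<open>Equality makes \<open>d1\<close>, \<open>count'\<close> and
          \<open>big'\<close> tight, and \<open>d0\<close> then yields
          \<open>card S <= card K1\<close>; as \<open>S\<close> is nonempty, both are 1.\<close>
        have "real (card S) + real (card K1) = 2" "real n = 2 + 3 * real (card K3)"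
          "real (card S) \<le> real (card K1)"
          using eq d0 d1 count' big' by argo+
        then have "card S + card K1 = 2" "n = 2 + 3 * card K3" "card S \<le> card K1"
          by linarith+
        then have S1: "card S = 1" and K11: "card K1 = 1" and n: "n = 2 + 3 * card K3"
          using s1 by auto
        obtain v where v: "S = {v}" using S1 by (auto simp: card_1_singleton_iff)
        obtain C where C: "K1 = {C}" using K11 by (auto simp: card_1_singleton_iff)
        have HD: "H = delete_vertex G v" by (simp add: H_def delete_vertex_def v)
        have C': "C \<in> components_of_graph H" "card (verts C) = 1" using C by (auto simp: K1_def)
        have "graph_isomorphic C (complete_graph 1)"
        proof (rule isomorphic_complete_graph)
          show "finite (verts C)" using finite_verts_component[OF H C'(1)] by simp
          have "card e \<noteq> 2" if "e \<subseteq> verts C" for e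
            using card_mono[OF \<open>finite (verts C)\<close> that] C' by simp
          moreover have "card e = 2" "e \<subseteq> verts C" if "e \<in> edges C" for e
            using that C'(1) H
            by (auto simp: components_of_graph_def induced_subgraph_def finite_simple_graph_def)
          ultimately show "edges C = {e. e \<subseteq> verts C \<and> card e = 2}" by blast
        qed (rule C')
        moreover have "graph_isomorphic D (complete_graph 3)" if "D \<in> components_of_graph H - {C}" for D
        proof -
          have D: "D \<in> K3" "D \<in> components_of_graph H" using that C K by auto
          \<comment> \<open>The members of \<open>K3\<close> have \<open>3 * card K3\<close>
            vertices in total and at least 3 each, hence exactly 3 each.\<close>
          have "(\<Sum>C\<in>K3. card (verts C)) = (\<Sum>C\<in>K3. 3)" 
            using n cVH cH S1 K11 by simp
          from sum_mono_inv[OF this[symmetric] K3_ge D(1) fK(2)] have "card (verts D) = 3" by simp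
          then show ?thesis by (rule factor_critical_3[OF H D(2) _ fc[OF D(2)]])
        qed
        ultimately show "\<exists>v\<in>verts G. \<exists>C\<in>components_of_graph (delete_vertex G v).
          graph_isomorphic C (complete_graph 1) \<and>
          (\<forall>D\<in>components_of_graph (delete_vertex G v) - {C}.
            graph_isomorphic D (complete_graph 3))"
          using C' S v HD by blast
      qed
    qed
  qed
qed

end
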